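(* For any proper, symmetric, open parameter $\mathcal{P}$, $\vDash^{\sim}_{\mathcal{P}}\ =\ \vDash^{\sim}_{\mathrm{ST}}$; that is, for all sets of formulas $\Gamma,\Delta$, $\Gamma\vDash^{\sim}_{\mathcal{P}}\Delta$ iff $\Gamma\vDash^{\sim}_{\mathrm{ST}}\Delta$.
   Context: First-order language with $\neg,\wedge,\vee,\to,\forall,\exists$, containing for each unary predicate $P$ a binary predicate $\sim_P$. Models $\langle D,I\rangle$: $D$ nonempty, $I(t)\in D$ for terms (variables and constants), $I(P):D^n\to[0,1]$; values: atomic by application, $I(\neg A)=1-I(A)$, $\wedge=\min$, $\vee=\max$, $I(A\to B)=\max(1-I(A),I(B))$, $I(\forall xA(x))$/$I(\exists xA(x))$ = glb/lub of values of $A(x)$ over $x$-variants. Standing restriction: only models with $I(t\sim_P t)=1$ and $I(t\sim_P u)=I(u\sim_P t)$ are considered. $V\subseteq[0,1]$ is closed if closed under arbitrary glb, lub and $x\mapsto1-x$. A parameter is $\langle V,T,F\rangle$ with $\{0,1\}\subseteq V\subseteq[0,1]$ closed, $1\in T\subseteq(0.5,1]$ an upset, $0\in F\subseteq[0,0.5)$ a downset. It is proper iff $V\not\subseteq T\cup F$; symmetric iff for all $x\in[0,1]$, $x\in T$ iff $1-x\in F$; open iff for all $X\subseteq V$, $\mathrm{glb}\,X\in F$ implies $F\cap X\neq\emptyset$ and $\mathrm{lub}\,X\in T$ implies $T\cap X\neq\emptyset$. $M$ is $\mathcal{P}$ tolerant iff for all $P,t,u$: $M(Pt)\in T$ and $M(Pu)\in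 F$ imply $M(t\sim_P u)\in F$. $\Gamma\vDash^{\sim}_{\mathcal{P}}\Delta$ iff there is no $\mathcal{P}$ tolerant model $M$ with $M(A)\in V$ for all formulas $A$, $M(\gamma)\in T$ for $\gamma\in\Gamma$, $M(\delta)\in F$ for $\delta\in\Delta$. $\vDash^{\sim}_{\mathrm{ST}}$ denotes $\vDash^{\sim}_{\mathcal{P}}$ for the parameter $\langle\{0,0.5,1\},\{1\},\{0\}\rangle$. *)

theory Defs
  imports Complex_Main
begin

(* Meets and joins in the complete lattice [0,1]; Inf and Sup on the reals
   are unspecified at the empty set. *)

definition glb :: "real set \<Rightarrow> real" where
  "glb X = (if X = {} then 1 else Inf X)"

definition lub :: "real set \<Rightarrow> real" where
  "lub X = (if X = {} then 0 else Sup X)"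


datatype 'c trm = Var nat | Const 'c

(* Sim P is the binary predicate ~_P; it belongs to the language only for unary P. *)
datatype 'p psym = Pred 'p | Sim 'p

datatype ('c, 'p) fm =
    Atom "'p psym" "'c trm list"
  | Neg "('c, 'p) fm"
  | Conj "('c, 'p) fm" "('c, 'p) fm"
  | Disj "('c, 'p) fm" "('c, 'p) fm"
  | Imp "('c, 'p) fm" "('c, 'p) fm"
  | All nat "('c, 'p) fm"
  | Ex nat "('c, 'p) fm"

(* Carrier sets rather than whole types, so that a language without constants is allowed. *)
record ('c, 'p) lang =
  constants :: "'c set"
  predicates :: "'p set"
  arity :: "'p \<Rightarrow> nat"

definition unary :: "('c, 'p) lang \<Rightarrow> 'p set" where
  "unary L = {P \<in> predicates L. arity L P = 1}"

definition terms :: "('c, 'p) lang \<Rightarrow> 'c trm set" where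
  "terms L = range Var \<union> Const ` constants L"

definition psyms :: "('c, 'p) lang \<Rightarrow> 'p psym set" where
  "psyms L = Pred ` predicates L \<union> Sim ` unary L"

fun psym_arity :: "('c, 'p) lang \<Rightarrow> 'p psym \<Rightarrow> nat" where
  "psym_arity L (Pred P) = arity L P"
| "psym_arity L (Sim P) = 2"

primrec is_formula :: "('c, 'p) lang \<Rightarrow> ('c, 'p) fm \<Rightarrow> bool" where
  "is_formula L (Atom R ts) \<longleftrightarrow>
     R \<in> psyms L \<and> length ts = psym_arity L R \<and> set ts \<subseteq> terms L"
| "is_formula L (Neg A) \<longleftrightarrow> is_formula L A"
| "is_formula L (Conj A B) \<longleftrightarrow> is_formula L A \<and> is_formula L B"
| "is_formula L (Disj A B) \<longleftrightarrow> is_formula L A \<and> is_formula L B"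
| "is_formula L (Imp A B) \<longleftrightarrow> is_formula L A \<and> is_formula L B"
| "is_formula L (All x A) \<longleftrightarrow> is_formula L A"
| "is_formula L (Ex x A) \<longleftrightarrow> is_formula L A"

definition formulas :: "('c, 'p) lang \<Rightarrow> ('c, 'p) fm set" where
  "formulas L = {A. is_formula L A}"


record ('c, 'p, 'd) interp =
  domain :: "'d set"
  iterm :: "'c trm \<Rightarrow> 'd"
  ipred :: "'p psym \<Rightarrow> 'd list \<Rightarrow> real"

definition variant :: "('c, 'p, 'd) interp \<Rightarrow> nat \<Rightarrow> 'd \<Rightarrow> ('c, 'p, 'd) interp" where
  "variant M x d = M\<lparr>iterm := (iterm M)(Var x := d)\<rparr>"

primrec val :: "('c, 'p) fm \<Rightarrow> ('c, 'p, 'd) interp \<Rightarrow> real" where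
  "val (Atom R ts) M = ipred M R (map (iterm M) ts)"
| "val (Neg A) M = 1 - val A M"
| "val (Conj A B) M = min (val A M) (val B M)"
| "val (Disj A B) M = max (val A M) (val B M)"
| "val (Imp A B) M = max (1 - val A M) (val B M)"
| "val (All x A) M = glb ((\<lambda>d. val A (variant M x d)) ` domain M)"
| "val (Ex x A) M = lub ((\<lambda>d. val A (variant M x d)) ` domain M)"

(* The last two conjuncts range over the terms of L, as does tolerance below;
   the x-variants in the quantifier clauses of val range over the whole domain
   and are not themselves required to satisfy these conditions. *)
definition is_model :: "('c, 'p) lang \<Rightarrow> ('c, 'p, 'd) interp \<Rightarrow> bool" where
  "is_model L M \<longleftrightarrow>
     domain M \<noteq> {} \<and>
     (\<forall>t \<in> terms L. iterm M t \<in> domain M) \<and>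
     (\<forall>R \<in> psyms L. \<forall>ds. length ds = psym_arity L R \<and> set ds \<subseteq> domain M \<longrightarrow>
        ipred M R ds \<in> {0..1}) \<and>
     (\<forall>P \<in> unary L. \<forall>t \<in> terms L. val (Atom (Sim P) [t, t]) M = 1) \<and>
     (\<forall>P \<in> unary L. \<forall>t \<in> terms L. \<forall>u \<in> terms L.
        val (Atom (Sim P) [t, u]) M = val (Atom (Sim P) [u, t]) M)"


record param =
  Vals :: "real set"
  Tr :: "real set"
  Fa :: "real set"

definition closed_vals :: "real set \<Rightarrow> bool" where
  "closed_vals V \<longleftrightarrow>
     (\<forall>X \<subseteq> V. glb X \<in> V) \<and> (\<forall>X \<subseteq> V. lub X \<in> V) \<and> (\<forall>x \<in> V. 1 - x \<in> V)"

definition parameter :: "param \<Rightarrow> bool" where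
  "parameter \<P> \<longleftrightarrow>
     {0, 1} \<subseteq> Vals \<P> \<and> Vals \<P> \<subseteq> {0..1} \<and> closed_vals (Vals \<P>) \<and>
     1 \<in> Tr \<P> \<and> Tr \<P> \<subseteq> {1/2<..1} \<and>
     (\<forall>x \<in> Tr \<P>. \<forall>y \<in> {0..1}. x \<le> y \<longrightarrow> y \<in> Tr \<P>) \<and>
     0 \<in> Fa \<P> \<and> Fa \<P> \<subseteq> {0..<1/2} \<and>
     (\<forall>x \<in> Fa \<P>. \<forall>y \<in> {0..1}. y \<le> x \<longrightarrow> y \<in> Fa \<P>)"

definition proper_param :: "param \<Rightarrow> bool" where
  "proper_param \<P> \<longleftrightarrow> \<not> Vals \<P> \<subseteq> Tr \<P> \<union> Fa \<P>"

definition symmetric_param :: "param \<Rightarrow> bool" where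
  "symmetric_param \<P> \<longleftrightarrow> (\<forall>x \<in> {0..1}. x \<in> Tr \<P> \<longleftrightarrow> 1 - x \<in> Fa \<P>)"

definition open_param :: "param \<Rightarrow> bool" where
  "open_param \<P> \<longleftrightarrow>
     (\<forall>X \<subseteq> Vals \<P>. (glb X \<in> Fa \<P> \<longrightarrow> Fa \<P> \<inter> X \<noteq> {}) \<and>
                    (lub X \<in> Tr \<P> \<longrightarrow> Tr \<P> \<inter> X \<noteq> {}))"

definition tolerant :: "('c, 'p) lang \<Rightarrow> param \<Rightarrow> ('c, 'p, 'd) interp \<Rightarrow> bool" where
  "tolerant L \<P> M \<longleftrightarrow>
     (\<forall>P \<in> unary L. \<forall>t \<in> terms L. \<forall>u \<in> terms L.
        val (Atom (Pred P) [t]) M \<in> Tr \<P> \<and> val (Atom (Pred P) [u]) M \<in> Fa \<P> \<longrightarrow>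
        val (Atom (Sim P) [t, u]) M \<in> Fa \<P>)"

(* HOL cannot quantify over types inside a definition, so the type from which
   the domains of models are drawn is an explicit argument. *)
definition consequence ::
  "'d itself \<Rightarrow> ('c, 'p) lang \<Rightarrow> param \<Rightarrow> ('c, 'p) fm set \<Rightarrow> ('c, 'p) fm set \<Rightarrow> bool" where
  "consequence (_ :: 'd itself) L \<P> \<Gamma> \<Delta> \<longleftrightarrow>
     \<not> (\<exists>M :: ('c, 'p, 'd) interp.
          is_model L M \<and> tolerant L \<P> M \<and>
          (\<forall>A \<in> formulas L. val A M \<in> Vals \<P>) \<and>
          (\<forall>\<gamma> \<in> \<Gamma>. val \<gamma> M \<in> Tr \<P>) \<and>
          (\<forall>\<delta> \<in> \<Delta>. val \<delta> M \<in> Fa \<P>))"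

definition ST :: param where
  "ST = \<lparr>Vals = {0, 1/2, 1}, Tr = {1}, Fa = {0}\<rparr>"

end

theory Submission
  imports Defs
begin

text \<open>
  Write \<open>V, T, F\<close> for the components of a parameter. If it is proper, symmetric and open, then
  \<open>b = glb (V - F)\<close> satisfies \<open>0 < b \<le> 1/2\<close> and on \<open>V\<close> the false values are exactly those below
  \<open>b\<close> and the true ones those above \<open>1 - b\<close>. Rounding the predicates of a model to 0 below \<open>b\<close>,
  to 1 above \<open>1 - b\<close> and to a fixed indeterminate value of another parameter otherwise
  makes every formula with value below \<open>b\<close> (above \<open>1 - b\<close>) take the value 0 (1). Since these are
  strict inequalities, they pass through infima and suprema even for quantifier instances whose
  values lie outside \<open>V\<close>, which happens for elements that no term denotes. Hence countermodels
  transfer between any two such parameters, and \<open>ST\<close> is one of them.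
\<close>

section \<open>Thresholds for truth and falsity in a parameter\<close>

definition threshold :: "param \<Rightarrow> real \<Rightarrow> bool" where
  "threshold \<P> b \<longleftrightarrow> 0 < b \<and> b \<le> 1/2 \<and>
     (\<forall>x \<in> Vals \<P>. (x \<in> Fa \<P> \<longleftrightarrow> x < b) \<and> (x \<in> Tr \<P> \<longleftrightarrow> 1 - b < x))"

lemma threshold_exists:
  assumes par: "parameter \<P>" and prp: "proper_param \<P>"
    and sym: "symmetric_param \<P>" and opn: "open_param \<P>"
  obtains b where "threshold \<P> b"
proof -
  define U where "U = Vals \<P> - Fa \<P>"
  define b where "b = glb U"
  have V01: "Vals \<P> \<subseteq> {0..1}" and zero: "0 \<in> Vals \<P>" "0 \<in> Fa \<P>"
    using par by (auto simp: parameter_def)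
  have neg: "1 - x \<in> Vals \<P>" if "x \<in> Vals \<P>" for x
    using par that by (auto simp: parameter_def closed_vals_def)
  have mirror: "x \<in> Tr \<P> \<longleftrightarrow> 1 - x \<in> Fa \<P>" if "x \<in> Vals \<P>" for x
    using sym that V01 by (auto simp: symmetric_param_def)
  obtain v where v: "v \<in> Vals \<P>" "v \<notin> Tr \<P>" "v \<notin> Fa \<P>"
    using prp by (auto simp: proper_param_def)
  \<comment> \<open>By symmetry \<open>1 - v\<close> is as indeterminate as \<open>v\<close>. Having
    both in \<open>U\<close> later bounds \<open>b\<close> by the smaller of the two, hence by
    1/2.\<close>
  then have v': "v \<in> U" "1 - v \<in> U"
    using neg mirror by (auto simp: U_def)
  have UV: "U \<subseteq> Vals \<P>" by (auto simp: U_def)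
  then have bV: "b \<in> Vals \<P>"
    using par by (auto simp: b_def parameter_def closed_vals_def)
  have "bdd_below U"
    using UV V01 by (intro bdd_belowI[of _ 0]) auto
  then have lower: "b \<le> x" if "x \<in> U" for x
    using that by (auto simp: b_def glb_def intro: cInf_lower)
  \<comment> \<open>Openness enters here: a false infimum would need a false member of
    \<open>U\<close>. So \<open>b\<close> itself is not false, which makes the bound on false values
    strict.\<close>
  have bF: "b \<notin> Fa \<P>"
  proof
    assume "b \<in> Fa \<P>"
    then have "Fa \<P> \<inter> U \<noteq> {}"
      using opn UV by (simp add: open_param_def b_def)
    then show False by (auto simp: U_def)
  qed
  have F: "x \<in> Fa \<P> \<longleftrightarrow> x < b" if "x \<in> Vals \<P>" for x
  proof
    assume x: "x \<in> Fa \<P>"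
    have "b \<in> Fa \<P>" if "b \<le> x"
      using par x that bV V01 unfolding parameter_def by blast
    with bF show "x < b" by force
  next
    assume "x < b"
    with lower that show "x \<in> Fa \<P>" by (force simp: U_def)
  qed
  have T: "x \<in> Tr \<P> \<longleftrightarrow> 1 - b < x" if "x \<in> Vals \<P>" for x
    using mirror[OF that] F[OF neg[OF that]] by auto
  have "0 < b" using F zero by auto
  moreover have "b \<le> 1/2" using lower[OF v'(1)] lower[OF v'(2)] by linarith
  ultimately show ?thesis
    using F T that by (auto simp: threshold_def)
qed

section \<open>Rounding of interpretations\<close>

definition rounding :: "real \<Rightarrow> real \<Rightarrow> real \<Rightarrow> real" where
  "rounding b v x = (if x < b then 0 else if 1 - b < x then 1 else v)"

definition round_interp ::
  "real \<Rightarrow> real \<Rightarrow> ('c, 'p, 'd) interp \<Rightarrow> ('c, 'p, 'd) interp" where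
  "round_interp b v M = M\<lparr>ipred := (\<lambda>R ds. rounding b v (ipred M R ds))\<rparr>"

lemma round_interp_simps [simp]:
  "domain (round_interp b v M) = domain M"
  "iterm (round_interp b v M) = iterm M"
  "ipred (round_interp b v M) R ds = rounding b v (ipred M R ds)"
  "variant (round_interp b v M) x d = round_interp b v (variant M x d)"
  by (simp_all add: round_interp_def variant_def)

lemma variant_simps [simp]:
  "domain (variant M x d) = domain M"
  "iterm (variant M x d) = (iterm M)(Var x := d)"
  "ipred (variant M x d) = ipred M"
  by (simp_all add: variant_def)

text \<open>Every rounded predicate value is 0, 1 or \<open>v\<close>, and closure of the value set
  carries membership through all connectives and quantifiers. Rounding commutes with variants, so
  the induction ranges over all \<open>M\<close>.\<close>

lemma val_round_interp_in_Vals: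
  assumes "parameter \<P>" and "v \<in> Vals \<P>"
  shows "val A (round_interp b v M) \<in> Vals \<P>"
proof (induction A arbitrary: M)
  case (Atom R ts)
  then show ?case
    using assms by (auto simp: rounding_def parameter_def)
qed (use assms in \<open>auto simp: parameter_def closed_vals_def min_def max_def image_subset_iff\<close>)

text \<open>The part of \<open>is_model\<close> that survives passing to variants; the similarity
  conditions may fail once a variable denotes an element that no term denoted before.\<close>

definition well_interp :: "('c, 'p) lang \<Rightarrow> ('c, 'p, 'd) interp \<Rightarrow> bool" where
  "well_interp L M \<longleftrightarrow>
     domain M \<noteq> {} \<and>
     (\<forall>t \<in> terms L. iterm M t \<in> domain M) \<and>
     (\<forall>R \<in> psyms L. \<forall>ds. length ds = psym_arity L R \<and> set ds \<subseteq> domain M \<longrightarrow>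
        ipred M R ds \<in> {0..1})"

lemma well_interp_variant:
  "well_interp L M \<Longrightarrow> d \<in> domain M \<Longrightarrow> well_interp L (variant M x d)"
  by (auto simp: well_interp_def)

lemma well_interp_round:
  "well_interp L M \<Longrightarrow> v \<in> {0..1} \<Longrightarrow> well_interp L (round_interp b v M)"
  by (auto simp: well_interp_def rounding_def)

section \<open>Values in the unit interval and their behaviour under rounding\<close>

lemma glb_in_unit:
  assumes "X \<noteq> {}" and "X \<subseteq> {0..1}"
  shows "glb X \<in> {0..1}"
proof -
  obtain x where "x \<in> X" using assms by auto
  moreover have "bdd_below X" using assms by (auto intro!: bdd_belowI[of _ 0])
  ultimately have "Inf X \<le> 1" using assms by (auto intro!: cInf_lower2[of x])
  moreover have "0 \<le> Inf X" using assms by (auto intro!: cInf_greatest)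
  ultimately show ?thesis using assms by (simp add: glb_def)
qed

lemma lub_in_unit:
  assumes "X \<noteq> {}" and "X \<subseteq> {0..1}"
  shows "lub X \<in> {0..1}"
proof -
  obtain x where "x \<in> X" using assms by auto
  moreover have "bdd_above X" using assms by (auto intro!: bdd_aboveI[of _ 1])
  ultimately have "0 \<le> Sup X" using assms by (auto intro!: cSup_upper2[of x])
  moreover have "Sup X \<le> 1" using assms by (auto intro!: cSup_least)
  ultimately show ?thesis using assms by (simp add: lub_def)
qed

lemma val_in_unit:
  assumes "well_interp L M" and "is_formula L A"
  shows "val A M \<in> {0..1}"
  using assms
proof (induction A arbitrary: M)
  case (Atom R ts)
  then have "length (map (iterm M) ts) = psym_arity L R" "set (map (iterm M) ts) \<subseteq> domain M"
    by (auto simp: well_interp_def)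
  with Atom show ?case
    unfolding well_interp_def val.simps is_formula.simps by blast
next
  case (All x A)
  then show ?case
    unfolding val.simps
    by (intro glb_in_unit) (auto simp: well_interp_variant, auto simp: well_interp_def)
next
  case (Ex x A)
  then show ?case
    unfolding val.simps
    by (intro lub_in_unit) (auto simp: well_interp_variant, auto simp: well_interp_def)
qed (auto simp: min_def max_def)

text \<open>An infimum strictly below \<open>b\<close> has a member below \<open>b\<close> as
  witness, even if it is not attained; an infimum above \<open>c\<close> forces every member above
  \<open>c\<close>, so the rounded image collapses to a single value.\<close>

lemma glb_image_round:
  fixes f g :: "'a \<Rightarrow> real"
  assumes "D \<noteq> {}" and fg: "f ` D \<subseteq> {0..1}" "g ` D \<subseteq> {0..1}"
    and low: "\<And>d. d \<in> D \<Longrightarrow> f d < b \<Longrightarrow> g d = 0"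
    and high: "\<And>d. d \<in> D \<Longrightarrow> c < f d \<Longrightarrow> g d = 1"
  shows "(glb (f ` D) < b \<longrightarrow> glb (g ` D) = 0) \<and> (c < glb (f ` D) \<longrightarrow> glb (g ` D) = 1)"
proof (intro conjI impI)
  have bdd: "bdd_below (f ` D)" "bdd_below (g ` D)"
    using fg by (auto intro!: bdd_belowI[of _ 0])
  {
    assume "glb (f ` D) < b"
    then obtain d where d: "d \<in> D" "f d < b"
      using \<open>D \<noteq> {}\<close> cInf_lessD[of "f ` D" b] by (auto simp: glb_def)
    then have "glb (g ` D) \<le> 0"
      using low bdd by (auto simp: glb_def intro!: cInf_lower2[of "g d"])
    with glb_in_unit[of "g ` D"] assms show "glb (g ` D) = 0" by auto
  }
  {
    assume "c < glb (f ` D)"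
    then have "c < f d" if "d \<in> D" for d
      using that cInf_lower[OF imageI[OF that] bdd(1)] by (auto simp: glb_def split: if_splits)
    then have "g ` D = {1}"
      using high \<open>D \<noteq> {}\<close> by force
    then show "glb (g ` D) = 1" by (simp add: glb_def)
  }
qed

lemma lub_image_round:
  fixes f g :: "'a \<Rightarrow> real"
  assumes "D \<noteq> {}" and fg: "f ` D \<subseteq> {0..1}" "g ` D \<subseteq> {0..1}"
    and low: "\<And>d. d \<in> D \<Longrightarrow> f d < b \<Longrightarrow> g d = 0"
    and high: "\<And>d. d \<in> D \<Longrightarrow> c < f d \<Longrightarrow> g d = 1"
  shows "(lub (f ` D) < b \<longrightarrow> lub (g ` D) = 0) \<and> (c < lub (f ` D) \<longrightarrow> lub (g ` D) = 1)"
proof (intro conjI impI)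
  have bdd: "bdd_above (f ` D)" "bdd_above (g ` D)"
    using fg by (auto intro!: bdd_aboveI[of _ 1])
  {
    assume "lub (f ` D) < b"
    then have "f d < b" if "d \<in> D" for d
      using that cSup_upper[OF imageI[OF that] bdd(1)] by (auto simp: lub_def split: if_splits)
    then have "g ` D = {0}"
      using low \<open>D \<noteq> {}\<close> by force
    then show "lub (g ` D) = 0" by (simp add: lub_def)
  }
  {
    assume "c < lub (f ` D)"
    then obtain d where d: "d \<in> D" "c < f d"
      using \<open>D \<noteq> {}\<close> less_cSupD[of "f ` D" c] by (auto simp: lub_def)
    then have "1 \<le> lub (g ` D)"
      using high bdd by (auto simp: lub_def intro!: cSup_upper2[of "g d"])
    with lub_in_unit[of "g ` D"] assms show "lub (g ` D) = 1" by auto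
  }
qed

text \<open>Both halves are proved together because negation exchanges them. Nothing is claimed for
  values from \<open>b\<close> to \<open>1 - b\<close>.\<close>

lemma val_round_interp:
  assumes "well_interp L M" and "is_formula L A" and "v \<in> {0..1}" and "b \<le> 1/2"
  shows "(val A M < b \<longrightarrow> val A (round_interp b v M) = 0) \<and>
         (1 - b < val A M \<longrightarrow> val A (round_interp b v M) = 1)"
  using assms(1,2)
proof (induction A arbitrary: M)
  case (Atom R ts)
  then show ?case using assms(4) by (auto simp: rounding_def)
next
  case (Neg A)
  then show ?case by force
next
  case (Conj A B)
  then have AB: "is_formula L A" "is_formula L B" by auto
  \<comment> \<open>One conjunct below \<open>b\<close> suffices: its rounded value 0 decides the
    minimum because the other rounded value is at least 0. The unit-interval facts provide this, and
    likewise below.\<close>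
  show ?case
    using Conj.IH(1)[OF Conj.prems(1) AB(1)] Conj.IH(2)[OF Conj.prems(1) AB(2)]
      val_in_unit[OF well_interp_round[OF Conj.prems(1) assms(3)] AB(1), of b]
      val_in_unit[OF well_interp_round[OF Conj.prems(1) assms(3)] AB(2), of b]
    by (auto simp: min_def max_def)
next
  case (Disj A B)
  then have AB: "is_formula L A" "is_formula L B" by auto
  show ?case
    using Disj.IH(1)[OF Disj.prems(1) AB(1)] Disj.IH(2)[OF Disj.prems(1) AB(2)]
      val_in_unit[OF well_interp_round[OF Disj.prems(1) assms(3)] AB(1), of b]
      val_in_unit[OF well_interp_round[OF Disj.prems(1) assms(3)] AB(2), of b]
    by (auto simp: min_def max_def)
next
  case (Imp A B)
  then have AB: "is_formula L A" "is_formula L B" by auto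
  show ?case
    using Imp.IH(1)[OF Imp.prems(1) AB(1)] Imp.IH(2)[OF Imp.prems(1) AB(2)]
      val_in_unit[OF well_interp_round[OF Imp.prems(1) assms(3)] AB(1), of b]
      val_in_unit[OF well_interp_round[OF Imp.prems(1) assms(3)] AB(2), of b]
    by (auto simp: min_def max_def)
next
  case (All x A)
  have D: "domain M \<noteq> {}" and A: "is_formula L A"
    using All.prems by (auto simp: well_interp_def)
  have w: "well_interp L (variant M x d)" if "d \<in> domain M" for d
    using All.prems that by (simp add: well_interp_variant)
  show ?case
    unfolding val.simps round_interp_simps
  proof (rule glb_image_round[OF D])
    show "(\<lambda>d. val A (variant M x d)) ` domain M \<subseteq> {0..1}"
      using val_in_unit[OF w A] by blast
    show "(\<lambda>d. val A (round_interp b v (variant M x d))) ` domain M \<subseteq> {0..1}"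
      using val_in_unit[OF well_interp_round[OF w assms(3)] A] by blast
  qed (use All.IH[OF w A] in blast)+
next
  case (Ex x A)
  have D: "domain M \<noteq> {}" and A: "is_formula L A"
    using Ex.prems by (auto simp: well_interp_def)
  have w: "well_interp L (variant M x d)" if "d \<in> domain M" for d
    using Ex.prems that by (simp add: well_interp_variant)
  show ?case
    unfolding val.simps round_interp_simps
  proof (rule lub_image_round[OF D])
    show "(\<lambda>d. val A (variant M x d)) ` domain M \<subseteq> {0..1}"
      using val_in_unit[OF w A] by blast
    show "(\<lambda>d. val A (round_interp b v (variant M x d))) ` domain M \<subseteq> {0..1}"
      using val_in_unit[OF well_interp_round[OF w assms(3)] A] by blast
  qed (use Ex.IH[OF w A] in blast)+
qed

section \<open>Transfer of countermodels\<close>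

lemma is_model_round_interp:
  assumes "is_model L M" and "v \<in> {0..1}" and "0 < b" and "b \<le> 1/2"
  shows "is_model L (round_interp b v M)"
proof -
  \<comment> \<open>This keeps similarity reflexive; \<open>0 < b\<close> places 1 above
    \<open>1 - b\<close>. Symmetry survives since equal values round equally.\<close>
  have "rounding b v 1 = 1"
    using assms by (auto simp: rounding_def)
  moreover have "rounding b v x \<in> {0..1}" for x
    using assms by (auto simp: rounding_def)
  ultimately show ?thesis
    using assms(1) by (simp add: is_model_def)
qed

lemma tolerant_round_interp:
  assumes M: "tolerant L \<P> M" "\<forall>A \<in> formulas L. val A M \<in> Vals \<P>"
    and b: "threshold \<P> b"
    and Q: "parameter \<Q>" "v \<notin> Tr \<Q>" "v \<notin> Fa \<Q>"
  shows "tolerant L \<Q> (round_interp b v M)"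
  unfolding tolerant_def
proof (intro ballI impI)
  fix P t u
  assume P: "P \<in> unary L" and t: "t \<in> terms L" and u: "u \<in> terms L"
  assume *: "val (Atom (Pred P) [t]) (round_interp b v M) \<in> Tr \<Q> \<and>
    val (Atom (Pred P) [u]) (round_interp b v M) \<in> Fa \<Q>"
  \<comment> \<open>The threshold describes truth and falsity only on
    \<open>Vals \<P>\<close>.\<close>
  have V: "val (Atom (Pred P) [t]) M \<in> Vals \<P>" "val (Atom (Pred P) [u]) M \<in> Vals \<P>"
    "val (Atom (Sim P) [t, u]) M \<in> Vals \<P>"
    using M(2) P t u by (auto simp: formulas_def psyms_def unary_def simp del: val.simps)
  \<comment> \<open>Since \<open>v\<close> is neither true nor false in \<open>\<Q>\<close>, a true
    rounded value must be 1 and a false one 0, which reveals the side of the threshold on which the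
    original value lies.\<close>
  have "0 \<in> Fa \<Q>" "0 \<notin> Tr \<Q>" "1 \<notin> Fa \<Q>"
    using Q(1) by (auto simp: parameter_def)
  with * Q have "1 - b < val (Atom (Pred P) [t]) M" "val (Atom (Pred P) [u]) M < b"
    by (auto simp: rounding_def split: if_splits)
  then have "val (Atom (Sim P) [t, u]) M < b"
    using M(1) P t u V b unfolding tolerant_def threshold_def by blast
  with \<open>0 \<in> Fa \<Q>\<close> show "val (Atom (Sim P) [t, u]) (round_interp b v M) \<in> Fa \<Q>"
    by (simp add: rounding_def)
qed

text \<open>By contraposition, rounding turns a countermodel for \<open>\<P>\<close> into one for
  \<open>\<Q>\<close>. The conditions on \<open>\<P>\<close> yield the threshold, and properness of
  \<open>\<Q>\<close> yields the middle value.\<close>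

lemma consequence_transfer:
  assumes P: "parameter \<P>" "proper_param \<P>" "symmetric_param \<P>" "open_param \<P>"
    and Q: "parameter \<Q>" "proper_param \<Q>"
    and sub: "\<Gamma> \<subseteq> formulas L" "\<Delta> \<subseteq> formulas L"
    and cons: "consequence TYPE('d) L \<Q> \<Gamma> \<Delta>"
  shows "consequence TYPE('d) L \<P> \<Gamma> \<Delta>"
  unfolding consequence_def
proof (rule notI, elim exE conjE)
  fix M :: "('a, 'b, 'd) interp"
  assume M: "is_model L M" "tolerant L \<P> M" "\<forall>A \<in> formulas L. val A M \<in> Vals \<P>"
    and \<Gamma>: "\<forall>\<gamma> \<in> \<Gamma>. val \<gamma> M \<in> Tr \<P>" and \<Delta>: "\<forall>\<delta> \<in> \<Delta>. val \<delta> M \<in> Fa \<P>"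
  obtain b where b: "threshold \<P> b"
    using threshold_exists[OF P] .
  then have b01: "0 < b" "b \<le> 1/2" by (auto simp: threshold_def)
  obtain v where v: "v \<in> Vals \<Q>" "v \<notin> Tr \<Q>" "v \<notin> Fa \<Q>"
    using Q(2) by (auto simp: proper_param_def)
  with Q(1) have v01: "v \<in> {0..1}" and ends: "1 \<in> Tr \<Q>" "0 \<in> Fa \<Q>"
    by (auto simp: parameter_def)
  have w: "well_interp L M"
    using M(1) by (simp add: is_model_def well_interp_def)
  have "val \<gamma> (round_interp b v M) \<in> Tr \<Q>" if "\<gamma> \<in> \<Gamma>" for \<gamma>
  proof -
    have \<gamma>: "is_formula L \<gamma>" "val \<gamma> M \<in> Vals \<P>"
      using that sub M(3) by (auto simp: formulas_def)
    with \<Gamma> that b have "1 - b < val \<gamma> M" by (auto simp: threshold_def)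
    with val_round_interp[OF w \<gamma>(1) v01 b01(2)] ends show ?thesis by simp
  qed
  moreover have "val \<delta> (round_interp b v M) \<in> Fa \<Q>" if "\<delta> \<in> \<Delta>" for \<delta>
  proof -
    have \<delta>: "is_formula L \<delta>" "val \<delta> M \<in> Vals \<P>"
      using that sub M(3) by (auto simp: formulas_def)
    with \<Delta> that b have "val \<delta> M < b" by (auto simp: threshold_def)
    with val_round_interp[OF w \<delta>(1) v01 b01(2)] ends show ?thesis by simp
  qed
  ultimately show False
    using cons is_model_round_interp[OF M(1) v01 b01] tolerant_round_interp[OF M(2,3) b Q(1) v(2,3)]
      val_round_interp_in_Vals[OF Q(1) v(1)]
    unfolding consequence_def by blast
qed

section \<open>The parameter \<open>ST\<close>\<close>

lemma glb_finite: "finite X \<Longrightarrow> glb X \<in> insert 1 X"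
  using Min_in[of X] by (auto simp: glb_def cInf_eq_Min)

lemma lub_finite: "finite X \<Longrightarrow> lub X \<in> insert 0 X"
  using Max_in[of X] by (auto simp: lub_def cSup_eq_Max)

lemma ST_properties:
  shows "parameter ST" and "proper_param ST" and "symmetric_param ST" and "open_param ST"
proof -
  have fin: "finite X" if "X \<subseteq> {0, 1/2, 1 :: real}" for X
    using that by (rule finite_subset) simp
  have "glb X \<in> {0, 1/2, 1}" "lub X \<in> {0, 1/2, 1}" if "X \<subseteq> {0, 1/2, 1}" for X
    using glb_finite[OF fin[OF that]] lub_finite[OF fin[OF that]] that by auto
  then have "closed_vals {0, 1/2, 1}"
    unfolding closed_vals_def by simp
  then show "parameter ST" by (auto simp: parameter_def ST_def)
  \<comment> \<open>The value 0 differs from the empty meet 1, so this finite infimum is attained;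
    dually for suprema.\<close>
  have "0 \<in> X" if "X \<subseteq> {0, 1/2, 1}" "glb X = 0" for X
    using glb_finite[OF fin[OF that(1)]] that(2) by auto
  moreover have "1 \<in> X" if "X \<subseteq> {0, 1/2, 1}" "lub X = 1" for X
    using lub_finite[OF fin[OF that(1)]] that(2) by auto
  ultimately show "open_param ST"
    by (auto simp: open_param_def ST_def)
qed (auto simp: proper_param_def symmetric_param_def ST_def)

theorem theorem2:
  fixes L :: "('c, 'p) lang" and \<P> :: param
  assumes "parameter \<P>" and "proper_param \<P>" and "symmetric_param \<P>" and "open_param \<P>"
  shows "\<forall>\<Gamma> \<Delta>. \<Gamma> \<subseteq> formulas L \<and> \<Delta> \<subseteq> formulas L \<longrightarrow>
    (consequence TYPE('d) L \<P> \<Gamma> \<Delta> \<longleftrightarrow> consequence TYPE('d) L ST \<Gamma> \<Delta>)"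
  \<comment> \<open>The two directions come from exchanging the roles of \<open>\<P>\<close> and
    \<open>ST\<close>.\<close>
  using consequence_transfer[OF assms ST_properties(1,2)]
    consequence_transfer[OF ST_properties assms(1,2)] by blast

end
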